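(* Let $\nu\ge\nu_0$, where $\nu_0\in(1,2)$ is the unique root of the equation $j_{\nu,1}^2=8(\nu+1)$. Then $$\mathcal{J}_\nu(x)\le\frac{j_{\nu,1}^2-x^2}{j_{\nu,1}^2+x^2}\quad\text{for all } |x|<j_{\nu,1},$$ and $$\frac{\mathcal{J}_{\nu+1}(x)}{\mathcal{J}_\nu(x)}\ge\left(\frac{j_{\nu,1}^2+x^2}{j_{\nu,1}^2-x^2}\right)^{\frac{1}{\nu+2}}\quad\text{for all } |x|<j_{\nu,1}.$$
   Context: $J_\nu$ is the Bessel function of the first kind, $j_{\nu,1}$ is its first positive zero, and $\mathcal{J}_\nu(x)=2^\nu\Gamma(\nu+1)x^{-\nu}J_\nu(x)$ is the normalized Bessel function (an even entire function with $\mathcal{J}_\nu(0)=1$). It is known that the equation $j_{\nu,1}^2=8(\nu+1)$ has exactly one root $\nu_0$ in $\nu>-1$, that $\nu_0\in(1,2)$, that $j_{\nu,1}^2\le8(\nu+1)$ for $\nu\in(-1,\nu_0]$ and $j_{\nu,1}^2\ge8(\nu+1)$ for $\nu\ge\nu_0$. *)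

theory Defs
  imports "HOL-Analysis.Analysis"
begin

text \<open>
  The Bessel function of the first kind of real order. The real function is meant for arguments
  \<open>x > 0\<close>; at a pole of \<open>Gamma\<close> the library has \<open>Gamma = 0\<close>, so that the corresponding
  coefficient vanishes, as required by the convention \<open>1/\<Gamma> = 0\<close> there.
\<close>

definition bessel_J :: "real \<Rightarrow> real \<Rightarrow> real" where
  "bessel_J \<nu> x =
     (\<Sum>m. (-1) ^ m / (fact m * Gamma (real m + \<nu> + 1)) * (x / 2) powr (2 * real m + \<nu>))"

definition bessel_first_zero :: "real \<Rightarrow> real" where
  "bessel_first_zero \<nu> = (LEAST x. 0 < x \<and> bessel_J \<nu> x = 0)"

text \<open>
  The formula \<open>2\<^sup>\<nu> \<Gamma>(\<nu>+1) x\<^sup>-\<^sup>\<nu> J\<^sub>\<nu>(x)\<close> makes sense for real \<open>x > 0\<close>. The normalized function is its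
  extension to an even function with value 1 at the origin, whose power series is the one given
  in the lemma \<open>normalized_bessel_sums\<close>.
\<close>

definition normalized_bessel :: "real \<Rightarrow> real \<Rightarrow> real" where
  "normalized_bessel \<nu> x =
     (if x = 0 then 1
      else 2 powr \<nu> * Gamma (\<nu> + 1) * \<bar>x\<bar> powr (-\<nu>) * bessel_J \<nu> \<bar>x\<bar>)"

lemma normalized_bessel_sums:
  fixes \<nu> x :: real
  assumes "\<nu> > -1"
  shows "(\<lambda>m. (-1) ^ m / (fact m * pochhammer (\<nu> + 1) m) * (x / 2) ^ (2 * m))
           sums normalized_bessel \<nu> x"
proof -
  define a where "a = (\<lambda>m. (-1) ^ m / (fact m * pochhammer (\<nu> + 1) m) * (x / 2) ^ (2 * m))"
  have poch: "pochhammer (\<nu> + 1) m > 0" for m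
    using assms by (intro pochhammer_pos) auto
  obtain N :: nat where N: "x\<^sup>2 + 1 \<le> real N" "1 \<le> N"
    using real_arch_simple[of "x\<^sup>2 + 1"] by (metis le_max_iff_disj max.cobounded2 nle_le of_nat_le_iff order_trans)
  have "summable a"
  proof (rule summable_ratio_test[where c = "1/2" and N = N])
    fix n assume n: "n \<ge> N"
    have pos: "\<nu> + 1 + real n \<ge> 1" using assms n N by linarith
    have eq: "a (Suc n) = a n * (- ((x / 2)\<^sup>2 / ((real n + 1) * (\<nu> + 1 + real n))))"
      using poch[of n] pos
      by (simp add: a_def pochhammer_Suc power2_eq_square field_simps)
    have "(x / 2)\<^sup>2 / ((real n + 1) * (\<nu> + 1 + real n)) \<le> (x / 2)\<^sup>2 / ((real n + 1) * 1)"
      using pos by (intro divide_left_mono mult_left_mono) auto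
    also have "\<dots> \<le> 1/2"
    proof -
      have "x\<^sup>2 + 1 \<le> real n" using n N by linarith
      thus ?thesis by (simp add: power_divide field_simps)
    qed
    finally have le: "(x / 2)\<^sup>2 / ((real n + 1) * (\<nu> + 1 + real n)) \<le> 1/2" .
    have ge: "0 \<le> (x / 2)\<^sup>2 / ((real n + 1) * (\<nu> + 1 + real n))" using pos by auto
    have "norm (a (Suc n)) = norm (a n) * ((x / 2)\<^sup>2 / ((real n + 1) * (\<nu> + 1 + real n)))"
      unfolding eq real_norm_def abs_mult abs_minus_cancel abs_of_nonneg[OF ge] ..
    also have "\<dots> \<le> norm (a n) * (1/2)" using le by (intro mult_left_mono) auto
    finally show "norm (a (Suc n)) \<le> 1/2 * norm (a n)" by simp
  qed auto
  have "suminf a = normalized_bessel \<nu> x"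
  proof (cases "x = 0")
    case True
    have "(\<lambda>m. a m) = (\<lambda>m. if m = 0 then 1 else 0)"
      by (auto simp: a_def True fun_eq_iff power_0_left)
    thus ?thesis using sums_single[of 0 "\<lambda>_. 1 :: real"] True
      by (simp add: normalized_bessel_def sums_iff)
  next
    case False
    define c where "c = Gamma (\<nu> + 1) * (\<bar>x\<bar> / 2) powr (-\<nu>)"
    have G: "Gamma (\<nu> + 1) > 0" using assms by (intro Gamma_real_pos) auto
    have c: "c > 0" using G False by (simp add: c_def)
    have nint: "\<nu> + 1 \<notin> \<int>\<^sub>\<le>\<^sub>0" using assms by (auto elim!: nonpos_Ints_cases)
    have "(-1) ^ m / (fact m * Gamma (real m + \<nu> + 1)) * (\<bar>x\<bar> / 2) powr (2 * real m + \<nu>)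
            = a m / c" for m
    proof -
      have "Gamma (real m + \<nu> + 1) = pochhammer (\<nu> + 1) m * Gamma (\<nu> + 1)"
        using pochhammer_Gamma[OF nint, of m] G by (simp add: add_ac)
      moreover have "(\<bar>x\<bar> / 2) powr (2 * real m + \<nu>) = (x / 2) ^ (2 * m) / (\<bar>x\<bar> / 2) powr (-\<nu>)"
      proof -
        have "(\<bar>x\<bar> / 2) powr (2 * real m) = (\<bar>x\<bar> / 2) ^ (2 * m)"
          using powr_realpow[of "\<bar>x\<bar> / 2" "2 * m"] False by simp
        also have "\<dots> = (x / 2) ^ (2 * m)" by (simp add: power_mult power_divide)
        finally show ?thesis by (simp add: powr_add powr_minus field_simps)
      qed
      ultimately show ?thesis by (simp add: a_def c_def)
    qed
    hence "bessel_J \<nu> \<bar>x\<bar> = suminf a / c"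
      unfolding bessel_J_def using \<open>summable a\<close> by (simp add: suminf_divide)
    moreover have "2 powr \<nu> * Gamma (\<nu> + 1) * \<bar>x\<bar> powr (-\<nu>) = c"
      using False by (simp add: c_def powr_divide powr_minus field_simps)
    ultimately show ?thesis using False c by (simp add: normalized_bessel_def)
  qed
  with \<open>summable a\<close> show ?thesis by (simp add: sums_iff a_def)
qed

end

theory Submission
  imports Defs
begin

text \<open>
  Everything is done in the variable \<open>t = x\<^sup>2\<close>, where the normalized Bessel function becomes a
  series \<open>f\<close> in \<open>t\<close> solving \<open>t f'' + a f' + f / 4 = 0\<close> with \<open>a = \<nu> + 1\<close>. Let \<open>J\<close> be its first zero.
  A Wronskian comparison of the rescaled functions \<open>s \<mapsto> f(a s)\<close> shows that \<open>J / a\<close> increases with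
  \<open>a\<close>, so \<open>J \<ge> 8 a\<close> for \<open>\<nu> \<ge> \<nu>\<^sub>0\<close>. A Sturm comparison with \<open>(J - t) / (J + t)\<close>, which also vanishes
  at \<open>J\<close>, then gives the first inequality. The Turan inequality for \<open>f\<close> with parameters
  \<open>a, a + 1, a + 2\<close> yields \<open>f\<^sub>a\<^sub>+\<^sub>1 / f\<^sub>a \<ge> f\<^sub>a powr (-1 / (a + 1))\<close>, which turns the first
  inequality into the second.
\<close>

section \<open>The normalized Bessel function as a power series in t = x^2\<close>

definition bcoeff :: "real \<Rightarrow> nat \<Rightarrow> real" where
  "bcoeff a m = (- 1 / 4) ^ m / (fact m * pochhammer a m)"

text \<open>This is the hypergeometric series 0F1(; a; -t/4), written f_a below.\<close>

definition bser :: "real \<Rightarrow> real \<Rightarrow> real" where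
  "bser a t = (\<Sum>m. bcoeff a m * t ^ m)"

lemma bcoeff_normalized:
  "bcoeff (\<nu> + 1) m * (x\<^sup>2) ^ m
     = (-1) ^ m / (fact m * pochhammer (\<nu> + 1) m) * (x / 2) ^ (2 * m)"
proof -
  have "(- 1 / 4) ^ m * (x\<^sup>2) ^ m = (-1) ^ m * ((x / 2)\<^sup>2) ^ m"
    unfolding power_mult_distrib[symmetric] by (simp add: power_divide)
  thus ?thesis by (simp add: bcoeff_def power_mult)
qed

lemma normalized_bessel_eq_bser:
  assumes "\<nu> > -1"
  shows "normalized_bessel \<nu> x = bser (\<nu> + 1) (x\<^sup>2)"
  using sums_unique[OF normalized_bessel_sums[OF assms, of x]]
  by (simp add: bser_def bcoeff_normalized)

lemma summable_bcoeff:
  assumes "a > 0"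
  shows "summable (\<lambda>m. bcoeff a m * t ^ m)"
proof (rule powser_inside)
  \<comment> \<open>\<open>powser_inside\<close> needs convergence at a point strictly beyond |t|;
    |t| + 1 serves, being the square of a real number.\<close>
  have "summable (\<lambda>m. bcoeff ((a - 1) + 1) m * ((sqrt (\<bar>t\<bar> + 1))\<^sup>2) ^ m)"
    unfolding bcoeff_normalized
    by (rule sums_summable[OF normalized_bessel_sums]) (use assms in simp)
  thus "summable (\<lambda>m. bcoeff a m * (\<bar>t\<bar> + 1) ^ m)" by simp
qed simp

lemma bser_0 [simp]: "bser a 0 = 1"
  using powser_zero[of "bcoeff a"] by (simp add: bser_def bcoeff_def)

lemma diffs_bcoeff:
  assumes "a > 0"
  shows "diffs (bcoeff a) m = - 1 / (4 * a) * bcoeff (a + 1) m"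
proof -
  have "pochhammer (a + 1) m > 0" using assms by (intro pochhammer_pos) auto
  thus ?thesis using assms
    by (simp add: diffs_def bcoeff_def pochhammer_rec divide_simps del: of_nat_Suc)
qed

lemma has_real_derivative_bser:
  assumes "a > 0"
  shows "(bser a has_real_derivative - bser (a + 1) t / (4 * a)) (at t)"
proof -
  have "((\<lambda>t. \<Sum>m. bcoeff a m * t ^ m) has_real_derivative
          (\<Sum>m. diffs (bcoeff a) m * t ^ m)) (at t)"
    using summable_bcoeff[OF assms, of "\<bar>t\<bar> + 1"] by (rule termdiffs_strong) simp
  moreover have "(\<Sum>m. diffs (bcoeff a) m * t ^ m) = - bser (a + 1) t / (4 * a)"
    using suminf_mult[OF summable_bcoeff[of "a + 1" t], of "- 1 / (4 * a)"] assms
    by (simp add: diffs_bcoeff bser_def mult.assoc)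
  ultimately show ?thesis by (simp add: bser_def [abs_def])
qed

lemmas bser_derivs [derivative_intros] = DERIV_chain2[OF has_real_derivative_bser]

lemma continuous_on_bser [continuous_intros]:
  assumes "a > 0" "continuous_on S f"
  shows "continuous_on S (\<lambda>t. bser a (f t))"
proof -
  have "continuous_on UNIV (bser a)"
    using has_real_derivative_bser[OF assms(1)] by (intro DERIV_continuous_on) auto
  from continuous_on_compose2[OF this assms(2)] show ?thesis by auto
qed

text \<open>Together with the derivative rule this is the equation t f'' + a f' + f / 4 = 0, since
  f' and f'' are multiples of the series with parameters a + 1 and a + 2.\<close>

lemma bser_recurrence:
  assumes "a > 0"
  shows "t * bser (a + 2) t = 4 * a * (a + 1) * (bser (a + 1) t - bser a t)"
proof -
  have c: "4 * a * (a + 1) * (bcoeff (a + 1) (Suc k) - bcoeff a (Suc k)) = bcoeff (a + 2) k" for k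
  proof -
    define P where "P = pochhammer (a + 2) k"
    have P: "P > 0" unfolding P_def using assms by (intro pochhammer_pos) auto
    have 1: "pochhammer (a + 1) (Suc k) = (a + 1) * P"
      by (simp add: pochhammer_rec P_def add.assoc)
    hence "pochhammer (a + 1) k = (a + 1) * P / (a + 1 + real k)"
      using assms by (simp add: pochhammer_Suc field_simps)
    hence 2: "pochhammer a (Suc k) = a * (a + 1) * P / (a + 1 + real k)"
      by (simp add: pochhammer_rec)
    have "a + 1 + real k > 0" "1 + real k > 0" using assms by auto
    thus ?thesis using assms P
      unfolding bcoeff_def 1 2 fact_Suc power_Suc P_def[symmetric]
      by (simp add: divide_simps) (simp add: algebra_simps)
  qed
  let ?d = "\<lambda>m. (bcoeff (a + 1) m - bcoeff a m) * t ^ m"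
  have "?d sums (bser (a + 1) t - bser a t)"
    unfolding bser_def left_diff_distrib
    using assms by (intro sums_diff summable_sums summable_bcoeff) auto
  \<comment> \<open>The constant terms cancel, so the series of the difference starts at index 1 and
    a factor t comes out.\<close>
  moreover have "?d 0 = 0" by (simp add: bcoeff_def)
  ultimately have "(\<lambda>k. ?d (Suc k)) sums (bser (a + 1) t - bser a t)"
    by (subst sums_Suc_iff) simp
  from sums_mult[OF this, of "4 * a * (a + 1)"]
  have "(\<lambda>k. t * (bcoeff (a + 2) k * t ^ k)) sums (4 * a * (a + 1) * (bser (a + 1) t - bser a t))"
    by (simp add: c [symmetric] mult_ac)
  moreover have "(\<lambda>k. t * (bcoeff (a + 2) k * t ^ k)) sums (t * bser (a + 2) t)"
    unfolding bser_def using assms by (intro sums_mult summable_sums summable_bcoeff) auto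
  ultimately show ?thesis by (rule sums_unique2[symmetric])
qed

section \<open>Nonnegativity from weighted derivatives\<close>

lemma has_real_derivative_powr_mult:
  assumes "t > 0" "(g has_real_derivative g') (at t)"
  shows "((\<lambda>t. t powr a * g t) has_real_derivative t powr (a - 1) * (a * g t + t * g')) (at t)"
proof -
  have "t powr a = t powr (a - 1) * t" using assms(1) by (simp add: powr_diff)
  thus ?thesis
    using assms by (auto intro!: derivative_eq_intros simp: algebra_simps)
qed

text \<open>The expression a g + t g' is t^(1-a) times the derivative of t^a g. As a > 0, the
  function t^a g vanishes at 0, so g needs no sign condition there.\<close>

lemma nonneg_if_weighted_derivative_nonneg:
  fixes g :: "real \<Rightarrow> real"
  assumes "a > 0" "T > 0" "continuous_on {0..T} g"
    and "\<And>t. 0 < t \<Longrightarrow> t < T \<Longrightarrow> (g has_real_derivative g' t) (at t)"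
    and "\<And>t. 0 < t \<Longrightarrow> t < T \<Longrightarrow> 0 \<le> a * g t + t * g' t"
  shows "0 \<le> g T"
proof -
  have "0 powr a * g 0 \<le> T powr a * g T"
  proof (rule DERIV_nonneg_imp_increasing_open[of 0 T "\<lambda>t. t powr a * g t"])
    fix t assume "0 < t" "t < T"
    thus "\<exists>y. ((\<lambda>t. t powr a * g t) has_real_derivative y) (at t) \<and> 0 \<le> y"
      using assms(4,5) 
      by (intro exI[of _ "t powr (a - 1) * (a * g t + t * g' t)"] conjI 
          has_real_derivative_powr_mult mult_nonneg_nonneg) auto
  next
    show "continuous_on {0..T} (\<lambda>t. t powr a * g t)"
      using assms(1,3) by (intro continuous_on_mult continuous_on_powr') (auto intro: continuous_on_id)
  qed (use assms(2) in simp)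
  thus ?thesis using assms(1,2) by (simp add: zero_le_mult_iff)
qed

text \<open>The recurrence gives (t^a f_(a+1))' = a t^(a-1) f_a, so nonnegativity passes from
  parameter a to a + 1.\<close>

lemma bser_Suc_nonneg:
  assumes "a > 0" "\<And>t. 0 \<le> t \<Longrightarrow> t < T \<Longrightarrow> 0 \<le> bser a t" "0 \<le> t" "t \<le> T"
  shows "0 \<le> bser (a + 1) t"
proof (cases "t = 0")
  case False
  show ?thesis
  proof (rule nonneg_if_weighted_derivative_nonneg[of a t "bser (a + 1)"])
    fix s assume s: "0 < s" "s < t"
    show "(bser (a + 1) has_real_derivative - bser (a + 2) s / (4 * (a + 1))) (at s)"
      using has_real_derivative_bser[of "a + 1" s] assms(1) by (simp add: add.assoc)
    have "a * bser (a + 1) s + s * (- bser (a + 2) s / (4 * (a + 1)))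
            = a * bser (a + 1) s - (s * bser (a + 2) s) / (4 * (a + 1))" by simp
    also have "\<dots> = a * bser a s"
      unfolding bser_recurrence[OF assms(1)] using assms(1) by (simp add: divide_simps) (simp add: algebra_simps)
    finally show "0 \<le> a * bser (a + 1) s + s * (- bser (a + 2) s / (4 * (a + 1)))"
      using assms s by simp
  qed (use assms False in \<open>auto intro!: continuous_intros\<close>)
qed simp

text \<open>The difference is t f_(a+2) / (4 a (a + 1)), and f_(a+2) inherits nonnegativity by
  raising the parameter twice.\<close>

lemma bser_le_bser_Suc:
  assumes "a > 0" "\<And>t. 0 \<le> t \<Longrightarrow> t < T \<Longrightarrow> 0 \<le> bser a t" "0 \<le> t" "t \<le> T"
  shows "bser a t \<le> bser (a + 1) t"
proof -
  have "0 \<le> t * bser (a + 1 + 1) t"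
    using assms by (intro mult_nonneg_nonneg bser_Suc_nonneg[of "a + 1" T]) (auto intro: bser_Suc_nonneg[of a T])
  hence "0 \<le> 4 * a * (a + 1) * (bser (a + 1) t - bser a t)"
    by (simp add: bser_recurrence[OF assms(1), symmetric] add.assoc)
  thus ?thesis using assms(1) by (simp add: zero_le_mult_iff mult_le_0_iff)
qed

section \<open>The first zero\<close>

text \<open>If there were no zero up to \<open>T = 4 a (a + 1)\<close>, the recurrence together with
  \<open>bser (a + 1) T \<le> bser (a + 2) T\<close> would give \<open>bser a T \<le> 0\<close>.\<close>

lemma bser_zero_exists:
  assumes "a > 0"
  shows "\<exists>t>0. bser a t \<le> 0"
proof (rule ccontr)
  assume "\<not> ?thesis"
  hence pos: "0 < bser a t" if "t \<ge> 0" for t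
    using that by (cases "t = 0") (auto simp: not_le)
  define T where "T = 4 * a * (a + 1)"
  have T: "T > 0" using assms by (simp add: T_def)
  have "bser (a + 1) T \<le> bser (a + 1 + 1) T"
    using assms pos T by (intro bser_le_bser_Suc[of "a + 1" T] bser_Suc_nonneg[of a T]) (auto intro: less_imp_le)
  moreover have "bser (a + 2) T = bser (a + 1) T - bser a T"
    using bser_recurrence[OF assms, of T, folded T_def] T by simp
  ultimately show False using pos[of T] T by (simp only: add.assoc one_add_one) simp
qed

lemma bser_first_zero:
  assumes "a > 0"
  obtains T where "T > 0" "bser a T = 0" "\<And>t. 0 \<le> t \<Longrightarrow> t < T \<Longrightarrow> 0 < bser a t"
proof -
  obtain b where b: "b > 0" "bser a b \<le> 0" using bser_zero_exists[OF assms] by blast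
  \<comment> \<open>Taking values <= 0 instead of zeros makes positivity before the minimum of
    \<open>Z\<close> immediate; the intermediate value theorem then shows that the minimum is a
    zero.\<close>
  define Z where "Z = {t \<in> {0..b}. bser a t \<le> 0}"
  have "compact Z"
    unfolding Z_def compact_eq_bounded_closed using assms
    by (intro conjI continuous_on_closed_Collect_le)
       (auto intro!: bounded_subset[OF bounded_closed_interval[of 0 b]] continuous_intros)
  moreover have "b \<in> Z" using b by (simp add: Z_def)
  ultimately obtain T where T: "T \<in> Z" "\<And>t. t \<in> Z \<Longrightarrow> T \<le> t"
    using compact_attains_inf[of Z] by blast
  have pos: "0 < bser a t" if "0 \<le> t" "t < T" for t
    using T that by (force simp: Z_def not_le)
  have "T \<noteq> 0" using T(1) by (auto simp: Z_def)
  hence "T > 0" using T(1) by (simp add: Z_def)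
  have "\<exists>x\<ge>0. x \<le> T \<and> bser a x = 0"
    using T(1) assms by (intro IVT2') (auto simp: Z_def intro!: continuous_intros)
  hence "bser a T = 0" using pos by (metis less_irrefl order_le_less)
  with that pos \<open>T > 0\<close> show thesis by blast
qed

lemma bessel_J_eq_0_iff:
  assumes "\<nu> > -1" "x > 0"
  shows "bessel_J \<nu> x = 0 \<longleftrightarrow> bser (\<nu> + 1) (x\<^sup>2) = 0"
proof -
  have "Gamma (\<nu> + 1) > 0" using assms by (intro Gamma_real_pos) auto
  hence "Gamma (\<nu> + 1) \<noteq> 0" by simp
  thus ?thesis
    using normalized_bessel_eq_bser[OF assms(1), of x] assms
    by (auto simp: normalized_bessel_def)
qed

text \<open>\<open>LEAST\<close> on the reals is informative only if a minimum is attained; the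
  first zero T of the series shows that it is attained at sqrt T.\<close>

lemma bessel_first_zero_props:
  assumes "\<nu> > -1"
  shows "bessel_first_zero \<nu> > 0"
    and "bser (\<nu> + 1) ((bessel_first_zero \<nu>)\<^sup>2) = 0"
    and "\<And>t. 0 \<le> t \<Longrightarrow> t < (bessel_first_zero \<nu>)\<^sup>2 \<Longrightarrow> 0 < bser (\<nu> + 1) t"
proof -
  from assms have "\<nu> + 1 > 0" by simp
  then obtain T where T: "T > 0" "bser (\<nu> + 1) T = 0"
      "\<And>t. 0 \<le> t \<Longrightarrow> t < T \<Longrightarrow> 0 < bser (\<nu> + 1) t"
    by (rule bser_first_zero) blast
  have "bessel_first_zero \<nu> = sqrt T"
    unfolding bessel_first_zero_def
  proof (rule Least_equality)
    show "0 < sqrt T \<and> bessel_J \<nu> (sqrt T) = 0"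
      using T assms by (simp add: bessel_J_eq_0_iff)
    fix x assume x: "0 < x \<and> bessel_J \<nu> x = 0"
    hence "bser (\<nu> + 1) (x\<^sup>2) = 0" using assms bessel_J_eq_0_iff by blast
    hence "T \<le> x\<^sup>2" using T(3)[of "x\<^sup>2"] by fastforce
    thus "sqrt T \<le> x" using x by (simp add: real_le_lsqrt)
  qed
  with T show "bessel_first_zero \<nu> > 0"
    and "bser (\<nu> + 1) ((bessel_first_zero \<nu>)\<^sup>2) = 0"
    and "\<And>t. 0 \<le> t \<Longrightarrow> t < (bessel_first_zero \<nu>)\<^sup>2 \<Longrightarrow> 0 < bser (\<nu> + 1) t"
    by simp_all
qed

section \<open>Turan inequality and the ratio of neighbouring parameters\<close>

lemma bser_turan:
  assumes "a > 0" "\<And>t. 0 \<le> t \<Longrightarrow> t < T \<Longrightarrow> 0 \<le> bser a t" "0 \<le> t" "t \<le> T"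
  shows "bser a t * bser (a + 2) t \<le> (bser (a + 1) t)\<^sup>2"
proof (cases "t = 0")
  case False
  let ?D = "\<lambda>t. (bser (a + 1) t)\<^sup>2 - bser a t * bser (a + 2) t"
  have "0 \<le> ?D t"
  \<comment> \<open>The weight a + 1 makes the f0 f2 terms cancel once f3 is eliminated; the
    recurrence for f1 - f0 then leaves a positive multiple of s f1 f2.\<close>
  proof (rule nonneg_if_weighted_derivative_nonneg[of "a + 1" t ?D])
    fix s assume s: "0 < s" "s < t"
    let ?f0 = "bser a s" and ?f1 = "bser (a + 1) s" and ?f2 = "bser (a + 2) s" 
      and ?f3 = "bser (a + 3) s"
    let ?D' = "- ?f1 * ?f2 / (2 * (a + 1)) + ?f1 * ?f2 / (4 * a) + ?f0 * ?f3 / (4 * (a + 2))"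
    show "(?D has_real_derivative ?D') (at s)"
      using assms(1)
      by (auto intro!: derivative_eq_intros simp: add.assoc divide_simps) 
         (simp_all add: algebra_simps)
    have r: "?f1 = ?f0 + s * ?f2 / (4 * a * (a + 1))"
      unfolding bser_recurrence[OF assms(1)] using assms(1) by simp
    have r': "s * ?f3 = 4 * (a + 1) * (a + 2) * (?f2 - ?f1)"
      using bser_recurrence[of "a + 1" s] assms(1) by (simp add: add.assoc)
    have "s * (?f0 * ?f3 / (4 * (a + 2))) = ?f0 * (s * ?f3) / (4 * (a + 2))" by simp
    also have "\<dots> = ?f0 * (a + 1) * (?f2 - ?f1)"
      unfolding r' using assms(1) by (simp add: field_simps)
    finally have "(a + 1) * ?D s + s * ?D' 
        = (a + 1) * ?f1 * (?f1 - ?f0) + s * (?f1 * ?f2) * (1 / (4 * a) - 1 / (2 * (a + 1)))"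
      by (simp add: algebra_simps power2_eq_square)
    also have "?f1 - ?f0 = s * ?f2 / (4 * a * (a + 1))" using r by simp
    also have "(a + 1) * ?f1 * (s * ?f2 / (4 * a * (a + 1))) 
        + s * (?f1 * ?f2) * (1 / (4 * a) - 1 / (2 * (a + 1))) = s * (?f1 * ?f2) / (2 * a * (a + 1))"
      using assms(1) by (simp add: divide_simps) (simp add: algebra_simps)
    finally have eq: "(a + 1) * ?D s + s * ?D' = s * (?f1 * ?f2) / (2 * a * (a + 1))" .
    have f1: "0 \<le> bser (a + 1) r" if "0 \<le> r" "r < t" for r
      using that assms by (intro bser_Suc_nonneg[of a T]) auto
    have "0 \<le> bser (a + 1 + 1) s"
      using assms f1 s by (intro bser_Suc_nonneg[of "a + 1" t]) auto
    with f1[of s] s assms(1) show "0 \<le> (a + 1) * ?D s + s * ?D'"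
      unfolding eq by (auto simp: add.assoc)
  qed (use assms False in \<open>auto intro!: continuous_intros\<close>)
  thus ?thesis by simp
qed simp

text \<open>The function f_(a+1)^(a+1) / f_a^a equals 1 at 0 and is nondecreasing: its exponents
  cancel the factors of the derivative rule, so the sign of its logarithmic derivative is the Turan
  inequality.\<close>

lemma bser_Suc_quotient_bound:
  assumes a: "a > 0" and pos: "\<And>t. 0 \<le> t \<Longrightarrow> t < T \<Longrightarrow> 0 < bser a t" 
    and t: "0 \<le> t" "t < T"
  shows "bser a t powr (- 1 / (a + 1)) \<le> bser (a + 1) t / bser a t"
proof -
  have pos1: "0 < bser (a + 1) s" if "0 \<le> s" "s < T" for s
    using bser_le_bser_Suc[of a T s] pos[OF that] a that by (force intro: less_imp_le pos)
  let ?g = "\<lambda>t. (a + 1) * ln (bser (a + 1) t) - a * ln (bser a t)"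
  have "?g 0 \<le> ?g t"
  proof (rule DERIV_nonneg_imp_nondecreasing[of 0 t ?g])
    fix s assume s: "0 \<le> s" "s \<le> t"
    have p: "0 < bser a s" "0 < bser (a + 1) s" using s t pos pos1 by auto
    let ?g' = "(bser (a + 1) s / bser a s - bser (a + 2) s / bser (a + 1) s) / 4"
    have "(?g has_real_derivative ?g') (at s)"
      using a p by (auto intro!: derivative_eq_intros simp: add.assoc divide_simps)
        (simp_all add: algebra_simps)
    moreover have "bser a s * bser (a + 2) s \<le> (bser (a + 1) s)\<^sup>2"
      using a s t by (intro bser_turan[of a T]) (auto intro: less_imp_le pos)
    hence "0 \<le> ?g'" using p by (simp add: divide_simps power2_eq_square mult.commute)
    ultimately show "\<exists>y. (?g has_real_derivative y) (at s) \<and> 0 \<le> y" by blast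
  qed (use t in simp)
  hence "a * ln (bser a t) \<le> (a + 1) * ln (bser (a + 1) t)" by simp
  hence "- 1 / (a + 1) * ln (bser a t) \<le> ln (bser (a + 1) t) - ln (bser a t)"
    using a by (simp add: divide_simps) (simp add: algebra_simps)
  also have "\<dots> = ln (bser (a + 1) t / bser a t)"
    using pos[OF t] pos1[OF t] by (simp add: ln_div)
  finally show ?thesis
    using pos[OF t] pos1[OF t] by (simp add: powr_def ln_ge_iff)
qed

section \<open>Monotonicity of J / a in the parameter\<close>

text \<open>\<open>s \<mapsto> bser a (a * s)\<close> solves \<open>s F'' + a F' + a F / 4 = 0\<close>; the weighted Wronskian of two
  such solutions is monotone, so \<open>bser b (b * s) / bser a (a * s)\<close> increases.\<close>

lemma bser_scaled_mono:
  assumes ab: "0 < a" "a \<le> b"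
    and pa: "\<And>s. 0 \<le> s \<Longrightarrow> s < T \<Longrightarrow> 0 < bser a (a * s)"
    and pb: "\<And>s. 0 \<le> s \<Longrightarrow> s < T \<Longrightarrow> 0 \<le> bser b (b * s)"
    and r: "0 \<le> r" "r < T"
  shows "bser a (a * r) \<le> bser b (b * r)"
proof -
  have b: "b > 0" using ab by simp
  \<comment> \<open>With F_a(s) = f_a(a s) the scaling gives F_a'(s) = - f_(a+1)(a s) / 4, so
    \<open>?G\<close> is four times the Wronskian F_b' F_a - F_b F_a'.\<close>
  let ?G = "\<lambda>s. bser b (b * s) * bser (a + 1) (a * s) - bser (b + 1) (b * s) * bser a (a * s)"
  have G: "0 \<le> ?G s" if s: "0 < s" "s < T" for s
  proof (rule nonneg_if_weighted_derivative_nonneg[of a s ?G])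
    fix t assume t: "0 < t" "t < s"
    let ?a0 = "bser a (a * t)" and ?a1 = "bser (a + 1) (a * t)" and ?a2 = "bser (a + 2) (a * t)"
    let ?b0 = "bser b (b * t)" and ?b1 = "bser (b + 1) (b * t)" and ?b2 = "bser (b + 2) (b * t)"
    let ?G' = "b / (4 * (b + 1)) * ?b2 * ?a0 - a / (4 * (a + 1)) * ?b0 * ?a2"
    show "(?G has_real_derivative ?G') (at t)"
      using ab b by (auto intro!: derivative_eq_intros simp: add.assoc divide_simps)
        (simp_all add: algebra_simps)
    have ra: "t * (a / (4 * (a + 1)) * ?a2) = a * (?a1 - ?a0)"
      using bser_recurrence[OF ab(1), of "a * t"] ab(1) by (simp add: field_simps)
    have rb: "t * (b / (4 * (b + 1)) * ?b2) = b * (?b1 - ?b0)"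
      using bser_recurrence[OF b, of "b * t"] b by (simp add: field_simps)
    have "t * ?G' = ?a0 * (t * (b / (4 * (b + 1)) * ?b2)) - ?b0 * (t * (a / (4 * (a + 1)) * ?a2))"
      by (simp add: algebra_simps)
    hence eq: "a * ?G t + t * ?G' = (b - a) * (?b1 - ?b0) * ?a0"
      unfolding ra rb by (simp add: algebra_simps)
    have "?b0 \<le> ?b1"
    proof (rule bser_le_bser_Suc[OF b, of "b * T"])
      fix u assume "0 \<le> u" "u < b * T"
      thus "0 \<le> bser b u" using pb[of "u / b"] b by (simp add: field_simps)
    qed (use b t s in auto)
    thus "0 \<le> a * ?G t + t * ?G'"
      unfolding eq using ab pa[of t] s t by simp
  qed (use ab b s in \<open>auto intro!: continuous_intros\<close>)
  have "bser b (b * 0) / bser a (a * 0) \<le> bser b (b * r) / bser a (a * r)"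
  proof (rule DERIV_nonneg_imp_nondecreasing[of 0 r "\<lambda>s. bser b (b * s) / bser a (a * s)"])
    fix s assume s: "0 \<le> s" "s \<le> r"
    have p: "0 < bser a (a * s)" using pa s r by simp
    have "((\<lambda>s. bser b (b * s) / bser a (a * s)) has_real_derivative 
        ?G s / (4 * (bser a (a * s))\<^sup>2)) (at s)"
      using ab b p by (auto intro!: derivative_eq_intros simp: divide_simps)
        (simp_all add: algebra_simps power2_eq_square)
    moreover have "0 \<le> ?G s" using G[of s] s r by (cases "s = 0") auto
    ultimately show "\<exists>y. ((\<lambda>s. bser b (b * s) / bser a (a * s)) has_real_derivative y) (at s) \<and> 0 \<le> y"
      by (meson divide_nonneg_nonneg mult_nonneg_nonneg zero_le_numeral zero_le_power2)
  qed (use r in simp)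
  thus ?thesis using pa[OF r] by simp
qed

text \<open>Otherwise the scaled function for \<nu> would vanish at a point where the one for \<mu>
  is still positive, against their ordering.\<close>

lemma bessel_first_zero_scaled_mono:
  assumes "-1 < \<mu>" "\<mu> \<le> \<nu>"
  shows "(bessel_first_zero \<mu>)\<^sup>2 / (\<mu> + 1) \<le> (bessel_first_zero \<nu>)\<^sup>2 / (\<nu> + 1)"
proof (rule ccontr)
  define a b where "a = \<mu> + 1" "b = \<nu> + 1"
  define A B where "A = (bessel_first_zero \<mu>)\<^sup>2" "B = (bessel_first_zero \<nu>)\<^sup>2"
  note d = a_b_def A_B_def
  have ab: "0 < a" "a \<le> b" "0 < b" "-1 < \<nu>" using assms by (auto simp: d)
  note A = bessel_first_zero_props[OF assms(1), folded d]
  note B = bessel_first_zero_props[OF ab(4), folded d]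
  assume "\<not> ?thesis"
  hence less: "B / b < A / a" by (simp add: d)
  have B0: "0 < B" using B(1) by (simp add: d)
  have pa: "0 < bser a (a * s)" if "0 \<le> s" "s < A / a" for s
    using A(3)[of "a * s"] that ab by (simp add: field_simps)
  have pb: "0 \<le> bser b (b * s)" if "0 \<le> s" "s < B / b" for s
    using B(3)[of "b * s"] that ab by (simp add: field_simps)
  have le: "bser a (a * s) \<le> bser b (b * s)" if "0 \<le> s" "s < B / b" for s
    using ab less that by (intro bser_scaled_mono[of a b "B / b"] pa pb) auto
  let ?g = "\<lambda>s. bser b (b * s) - bser a (a * s)"
  \<comment> \<open>The comparison is available only strictly below B / b; continuity carries it to
    the endpoint.\<close>
  have "0 \<le> ?g (B / b)"
  proof (rule continuous_ge_on_closure[of "{0..<B / b}" ?g])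
    show "continuous_on (closure {0..<B / b}) ?g"
      using ab by (intro continuous_intros) auto
    show "B / b \<in> closure {0..<B / b}" using B0 ab by simp
  qed (use le in auto)
  hence "bser a (a * (B / b)) \<le> 0" using B(2) ab by simp
  with pa[of "B / b"] less B0 ab show False by simp
qed

section \<open>Sturm comparison with a rational function\<close>

text \<open>Sturm comparison with \<open>y = (J - t) / (J + t)\<close>: the weighted Wronskian vanishes at both ends
  of \<open>[0, J]\<close>, and the sign of its derivative is that of a polynomial that changes sign at most
  once, from minus to plus.\<close>

lemma bser_le_rational:
  assumes a: "a > 1" and J: "8 * a \<le> J" "bser a J = 0"
    and pos: "\<And>t. 0 \<le> t \<Longrightarrow> t < J \<Longrightarrow> 0 < bser a t"
    and t: "0 \<le> t" "t < J"
  shows "bser a t \<le> (J - t) / (J + t)"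
proof -
  have J0: "J > 0" and a0: "a > 0" using a J by simp_all
  \<comment> \<open>For y = (J - t) / (J + t), \<open>Q\<close> is -(J + t)^3 (t y'' + a y' + y /
    4), and \<open>p\<close> is the slope (Q(t) - Q(0)) / t, nondecreasing for t >= 0.\<close>
  define Q where "Q = (\<lambda>t. 2 * a * J * (J + t) - 4 * J * t - (J - t) * (J + t)\<^sup>2 / 4)"
  define p where "p = (\<lambda>t. 2 * a * J - 4 * J - (J\<^sup>2 - J * t - t\<^sup>2) / 4)"
  have Qp: "Q t = (2 * a * J\<^sup>2 - J ^ 3 / 4) + t * p t" for t
    by (simp add: Q_def p_def field_simps power2_eq_square power3_eq_cube)
  \<comment> \<open>The bound 8 a <= J says exactly that Q(0) <= 0.\<close>
  have Q0: "2 * a * J\<^sup>2 - J ^ 3 / 4 \<le> 0"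
  proof -
    have "8 * a * J\<^sup>2 \<le> J * J\<^sup>2" using J by (intro mult_right_mono) auto
    thus ?thesis by (simp add: power2_eq_square power3_eq_cube)
  qed
  \<comment> \<open>As Q(0) <= 0, Q(x) > 0 forces p(x) > 0, and monotonicity of \<open>p\<close>
    then gives Q(z) >= Q(x).\<close>
  have sign: False if "0 < x" "x < z" "Q z < 0" "0 < Q x" for x z
  proof -
    have "x\<^sup>2 \<le> z\<^sup>2" using that by (intro power_mono) auto
    moreover have "J * x \<le> J * z" using that J0 by simp
    ultimately have "p x \<le> p z" by (simp add: p_def)
    hence "x * p x \<le> x * p z" using that by simp
    have "0 < x * p x" using that(4) Q0 Qp[of x] by linarith
    hence "0 < p z" using \<open>x * p x \<le> x * p z\<close> that(1) 
      by (meson order_less_le_trans zero_less_mult_pos)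
    hence "x * p z \<le> z * p z" using that by simp
    hence "Q x \<le> Q z" using Qp \<open>x * p x \<le> x * p z\<close> by simp
    with that show False by simp
  qed
  let ?y = "\<lambda>t. (J - t) / (J + t)"
  \<comment> \<open>This is the Wronskian f' y - f y'; the factor t^a in \<open>V\<close> is the
    integrating factor of the equation.\<close>
  define g where "g = (\<lambda>t. - bser (a + 1) t / (4 * a) * ?y t + bser a t * (2 * J / (J + t)\<^sup>2))"
  define V where "V = (\<lambda>t. t powr a * g t)"
  have y': "(?y has_real_derivative - (2 * J / (J + t)\<^sup>2)) (at t)" if "J + t > 0" for t
    using that by (auto intro!: derivative_eq_intros simp: power2_eq_square divide_simps)
  have y'': "((\<lambda>t. 2 * J / (J + t)\<^sup>2) has_real_derivative - (4 * J / (J + t) ^ 3)) (at t)" 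
    if "J + t > 0" for t
    using that by (auto intro!: derivative_eq_intros simp: power2_eq_square power3_eq_cube divide_simps)
  have V': "(V has_real_derivative t powr (a - 1) * (bser a t / (J + t) ^ 3 * Q t)) (at t)" 
    if "t > 0" for t
  proof -
    have n: "J + t > 0" using that J0 by simp
    let ?g' = "bser (a + 2) t / (16 * a * (a + 1)) * ?y t - bser a t * (4 * J / (J + t) ^ 3)"
    have "((\<lambda>t. - bser (a + 1) t / (4 * a)) has_real_derivative 
        bser (a + 2) t / (16 * a * (a + 1))) (at t)"
      using a by (auto intro!: derivative_eq_intros simp: add.assoc)
    from DERIV_add[OF DERIV_mult[OF this y'[OF n]] 
        DERIV_mult[OF has_real_derivative_bser[OF a0] y''[OF n]]]
    \<comment> \<open>The two products f' y' cancel in the derivative of the Wronskian.\<close>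
    moreover have "p * y + - q * r + (r * q + - e * f) = p * y - f * e" for p y q r e f :: real
      by (simp add: algebra_simps)
    ultimately have "(g has_real_derivative ?g') (at t)"
      unfolding g_def by (simp only:)
    from has_real_derivative_powr_mult[OF that this, of a]
    have "(V has_real_derivative t powr (a - 1) * (a * g t + t * ?g')) (at t)"
      unfolding V_def .
    moreover have "a * g t + t * ?g' = bser a t / (J + t) ^ 3 * Q t"
    proof -
      have r: "t * bser (a + 2) t / (16 * a * (a + 1)) = (bser (a + 1) t - bser a t) / 4"
        unfolding bser_recurrence[OF a0] using a0
        by (simp add: divide_eq_eq)
      have alg: "a * (- f1 / (4 * a) * y + f0 * d) + ((f1 - f0) / 4 * y - f0 * e) 
          = f0 * (a * d - y / 4 - e)" for f0 f1 y d e :: real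
        using a0 by (simp add: field_simps)
      have frac: "a * (2 * J / n\<^sup>2) - u / n / 4 - e / n ^ 3 = (2 * a * J * n - e - u * n\<^sup>2 / 4) / n ^ 3"
        if "n > 0" for n u e
        using that by (simp add: diff_divide_distrib power2_eq_square power3_eq_cube)
      have "t * ?g' = t * bser (a + 2) t / (16 * a * (a + 1)) * ?y t
              - bser a t * (4 * J * t / (J + t) ^ 3)"
        by (simp add: algebra_simps)
      hence "a * g t + t * ?g' = 
          bser a t * (a * (2 * J / (J + t)\<^sup>2) - ?y t / 4 - 4 * J * t / (J + t) ^ 3)"
        unfolding r g_def by (simp only: alg)
      also have "\<dots> = bser a t * (Q t / (J + t) ^ 3)"
        unfolding Q_def frac[OF n] ..
      finally show ?thesis by simp
    qed
    ultimately show ?thesis by simp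
  qed
  have contV: "continuous_on {0..J} V"
    unfolding V_def g_def using a J0
    by (intro continuous_on_mult[of _ "\<lambda>t. t powr a"] continuous_on_powr') (auto intro!: continuous_intros)
  have mvt: "\<exists>l z. u < z \<and> z < v \<and> (V has_real_derivative l) (at z) \<and> V v - V u = (v - u) * l"
    if uv: "0 \<le> u" "u < v" "v \<le> J" for u v
  proof -
    have "continuous_on {u..v} V" by (rule continuous_on_subset[OF contV]) (use uv in auto)
    moreover have "V differentiable (at z)" if "u < z" "z < v" for z
      using V'[of z] that uv unfolding real_differentiable_def by (meson order_le_less_trans)
    ultimately show ?thesis using MVT[OF uv(2)] by metis
  qed
  \<comment> \<open>At 0 the weight vanishes, at J both f and y do.\<close>
  have V0: "V 0 = 0" "V J = 0" using J by (simp_all add: V_def g_def)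
  \<comment> \<open>By the mean value theorem a positive value would make \<open>V\<close> rise
    before x and fall after it, so \<open>Q\<close> would go from plus to minus, which
    \<open>sign\<close> excludes.\<close>
  have gle: "g x \<le> 0" if x: "0 < x" "x < J" for x
  proof (rule ccontr)
    assume "\<not> g x \<le> 0"
    hence Vx: "V x > 0" using x by (simp add: V_def)
    obtain l1 z1 where 1: "0 < z1" "z1 < x" "(V has_real_derivative l1) (at z1)" 
        "V x - V 0 = (x - 0) * l1"
      using mvt[of 0 x] x by auto
    obtain l2 z2 where 2: "x < z2" "z2 < J" "(V has_real_derivative l2) (at z2)" 
        "V J - V x = (J - x) * l2"
      using mvt[of x J] x by auto
    have w: "0 < z powr (a - 1) * (bser a z / (J + z) ^ 3)" if "0 < z" "z < J" for z
      using that pos[of z] J0 by simp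
    have "0 < x * l1" "(J - x) * l2 < 0" using 1(4) 2(4) Vx V0 by simp_all
    hence "0 < l1" "l2 < 0" using x by (simp_all add: zero_less_mult_iff mult_less_0_iff)
    moreover have "l1 = z1 powr (a - 1) * (bser a z1 / (J + z1) ^ 3) * Q z1"
      using DERIV_unique[OF 1(3) V'] 1 by (simp add: mult.assoc)
    moreover have "l2 = z2 powr (a - 1) * (bser a z2 / (J + z2) ^ 3) * Q z2"
      using DERIV_unique[OF 2(3) V'] 1 2 by (simp add: mult.assoc)
    ultimately have "0 < Q z1" "Q z2 < 0"
      using w[of z1] w[of z2] 1(1,2) 2(1,2) x 
      by (metis less_trans zero_less_mult_pos, metis less_trans mult_less_0_iff less_asym)
    with sign[of z1 z2] 1 2 show False by simp
  qed
  \<comment> \<open>The quotient f / y has derivative g / y^2 <= 0 and equals 1 at 0.\<close>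
  have "bser a t / ?y t \<le> bser a 0 / ?y 0"
  proof (rule DERIV_nonpos_imp_decreasing_open[of 0 t "\<lambda>s. bser a s / ?y s"])
    fix s assume s: "0 < s" "s < t"
    hence n: "J + s > 0" "J - s > 0" using t by auto
    have "((\<lambda>s. bser a s / ?y s) has_real_derivative g s / (?y s)\<^sup>2) (at s)"
      using DERIV_divide[OF has_real_derivative_bser[OF a0] y'[OF n(1)]] n
      by (simp only: g_def power2_eq_square[of "?y s"] mult_minus_right diff_minus_eq_add) simp
    moreover have "g s / (?y s)\<^sup>2 \<le> 0"
      using gle[of s] s t by (intro divide_nonpos_nonneg) auto
    ultimately show "\<exists>y. ((\<lambda>s. bser a s / ?y s) has_real_derivative y) (at s) \<and> y \<le> 0" by blast
  qed (use t a J0 in \<open>auto intro!: continuous_intros\<close>)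
  thus ?thesis using t J0 by (simp add: divide_simps split: if_splits)
qed

section \<open>The two inequalities for the Bessel functions\<close>

theorem theorem10:
  fixes \<nu> \<nu>\<^sub>0 :: real
  assumes "1 < \<nu>\<^sub>0" and "\<nu>\<^sub>0 < 2"
    and "(bessel_first_zero \<nu>\<^sub>0)\<^sup>2 = 8 * (\<nu>\<^sub>0 + 1)"
    and "\<nu> \<ge> \<nu>\<^sub>0"
  shows "(\<forall>x. \<bar>x\<bar> < bessel_first_zero \<nu> \<longrightarrow>
            normalized_bessel \<nu> x
              \<le> ((bessel_first_zero \<nu>)\<^sup>2 - x\<^sup>2) / ((bessel_first_zero \<nu>)\<^sup>2 + x\<^sup>2)) \<and>
         (\<forall>x. \<bar>x\<bar> < bessel_first_zero \<nu> \<longrightarrow>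
            normalized_bessel (\<nu> + 1) x / normalized_bessel \<nu> x
              \<ge> (((bessel_first_zero \<nu>)\<^sup>2 + x\<^sup>2) / ((bessel_first_zero \<nu>)\<^sup>2 - x\<^sup>2))
                  powr (1 / (\<nu> + 2)))"
proof -
  define J where "J = (bessel_first_zero \<nu>)\<^sup>2"
  have \<nu>: "\<nu> > 1" "\<nu> > -1" using assms by auto
  note z = bessel_first_zero_props[OF \<nu>(2), folded J_def]
  \<comment> \<open>Monotonicity of J / (\<nu> + 1) carries the value 8 at
    \<open>\<nu>\<^sub>0\<close> to a lower bound at \<nu>.\<close>
  have "8 = (bessel_first_zero \<nu>\<^sub>0)\<^sup>2 / (\<nu>\<^sub>0 + 1)"
    unfolding assms(3) using assms(1) by (simp add: field_simps)
  also have "\<dots> \<le> J / (\<nu> + 1)"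
    using bessel_first_zero_scaled_mono[of \<nu>\<^sub>0 \<nu>] assms(1,4) by (simp add: J_def)
  finally have "8 \<le> J / (\<nu> + 1)" .
  hence J: "8 * (\<nu> + 1) \<le> J" using \<nu> by (simp add: field_simps)
  have lt: "x\<^sup>2 < J" if "\<bar>x\<bar> < bessel_first_zero \<nu>" for x
    unfolding J_def using that by (metis abs_ge_zero abs_of_pos power2_abs power_strict_mono zero_less_numeral z(1))
  have 1: "bser (\<nu> + 1) (x\<^sup>2) \<le> (J - x\<^sup>2) / (J + x\<^sup>2)" if "\<bar>x\<bar> < bessel_first_zero \<nu>" for x
    using \<nu> lt[OF that] by (intro bser_le_rational J z(2,3)) auto
  have 2: "((J + x\<^sup>2) / (J - x\<^sup>2)) powr (1 / (\<nu> + 2)) 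
             \<le> bser (\<nu> + 1 + 1) (x\<^sup>2) / bser (\<nu> + 1) (x\<^sup>2)" 
    if x: "\<bar>x\<bar> < bessel_first_zero \<nu>" for x
  proof -
    have p: "0 < bser (\<nu> + 1) (x\<^sup>2)" using z(3) lt[OF x] by simp
    have d: "0 < (J - x\<^sup>2) / (J + x\<^sup>2)" using lt[OF x] by (smt (verit) divide_pos_pos zero_le_power2)
    \<comment> \<open>Inverting the base makes the exponent negative; such a power is decreasing, so
      the upper bound for f_a turns into the required lower bound.\<close>
    have "((J + x\<^sup>2) / (J - x\<^sup>2)) powr (1 / (\<nu> + 2)) 
            = ((J - x\<^sup>2) / (J + x\<^sup>2)) powr (- 1 / (\<nu> + 1 + 1))"
      using lt[OF x] by (simp add: powr_divide powr_minus add.assoc field_simps)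
    also have "\<dots> \<le> bser (\<nu> + 1) (x\<^sup>2) powr (- 1 / (\<nu> + 1 + 1))"
      using p d 1[OF x] \<nu> by (intro powr_mono2') auto
    also have "\<dots> \<le> bser (\<nu> + 1 + 1) (x\<^sup>2) / bser (\<nu> + 1) (x\<^sup>2)"
      using \<nu> lt[OF x] by (intro bser_Suc_quotient_bound z(3)) auto
    finally show ?thesis .
  qed
  show ?thesis
    using 1 2 \<nu> by (simp add: normalized_bessel_eq_bser J_def)
qed

end
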